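(* Let $\mathbb{F}\in\{\mathbb{R},\mathbb{C}\}$, $n\in\mathbb{N}$, $r\in\mathbb{Z}_+$, let $\mathcal{A}\in\mathbb{F}^{n\times n}/{\sim}$ and $\mathcal{B}\in\mathbb{F}^{n\times r}/{\sim}$ be nonzero patterns, and let $t_0,t_1\in\mathbb{Z}$ with $t_0<t_1$. Put $N=t_1-t_0$ and define the pattern $\mathcal{K}\in\mathbb{F}^{nN\times(n+r)N}/{\sim}$ by $$ \mathcal{K}= \begin{pmatrix} [0]_{\sim} & [\mathrm{id}]_{\sim} & & & \mathcal{B} & & & \\ & \mathcal{A} & \ddots & & & \mathcal{B} & & \\ & & \ddots & [\mathrm{id}]_{\sim} & & & \ddots & \\ & & & \mathcal{A} & & & & \mathcal{B} \end{pmatrix}, $$ that is, $\mathcal{K}$ has $N$ block rows of height $n$, followed across by $N$ block columns of width $n$ (numbered $1,\dots,N$) and then $N$ block columns of width $r$ (numbered $N+1,\dots,2N$); the block at position $(i,i+1)$ is $[\mathrm{id}]_{\sim}$ for $1\le i\le N-1$, the block at position $(i,i)$ is $\mathcal{A}$ for $2\le i\le N$, the block at position $(i,N+i)$ is $\mathcal{B}$ for $1\le i\le N$, and all other blocks (in particular the entire first block column) are zero patterns of suitable sizes. Consider the condition ($G_3$) For every non-empty subset $V\subseteq\{1,\dots,n(t_1-t_0)\}$ of vertices of the graph $\mathcal{G}(\mathcal{K})$ there exists some vertex $v\in\{1,\dots,(n+r)(t_1-t_0)\}$ such that $V$ contains exactly one successor of $v$ in $\mathcal{G}(\mathcal{K})$.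 Then the following holds. (i) Every discrete-time system $x(t+1)=A(t)x(t)+B(t)u(t)$ of pattern $(\mathcal{A},\mathcal{B})$ is controllable on $[t_0,t_1]$ if and only if condition ($G_3$) holds. (ii) If additionally $t_0+n\le t_1$, then every discrete-time system $x(t+1)=A(t)x(t)+B(t)u(t)$ of pattern $(\mathcal{A},\mathcal{B})$ is controllable on $[t_0,t_1]$ if and only if every time-invariant discrete-time system $x(t+1)=A(t)x(t)+B(t)u(t)$ of pattern $(\mathcal{A},\mathcal{B})$ is controllable on $[t_0,t_1]$.
   Context: $\mathbb{Z}_+$ is the set of non-negative integers, $\mathbb{N}=\mathbb{Z}_+\setminus\{0\}$, and intervals in the discrete-time setting are intervals of integers. Nonzero patterns: for $X,Y\in\mathbb{F}^{p\times q}$ write $X\sim Y$ iff the positions of the zero entries of $X$ and $Y$ coincide. The equivalence classes $[X]_{\sim}\in\mathbb{F}^{p\times q}/{\sim}$ are called (nonzero) patterns; a pattern is represented by a matrix of symbols $\star$ (nonzero entry) and $\circ$ (zero entry). $\mathrm{id}$ is the identity matrix (here $n\times n$). Block composition of patterns is defined through representatives, e.g. $([X]_{\sim},[Y]_{\sim})=[(X,Y)]_{\sim}$. Graph: for a pattern $\mathcal{K}$ of size $p\times q$ with $p\le q$, the directed graph $\mathcal{G}(\mathcal{K})$ has vertices $1,\dots,q$, and there is an edge from vertex $v$ to vertex $w$ iff $1\le w\le p$ and $\mathcal{K}_{w,v}=\star$. In that case $w$ is called a successor of $v$. Systems: a discrete-time system $x(t+1)=A(t)x(t)+B(t)u(t)$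 over $\mathbb{F}$ is given by coefficient matrices $A(t)\in\mathbb{F}^{n\times n}$, $B(t)\in\mathbb{F}^{n\times r}$ for all $t\in\mathbb{Z}$. It is time-invariant if $A(t)$ and $B(t)$ do not depend on $t$. It is of pattern $(\mathcal{A},\mathcal{B})$ if $A(t)\in\mathcal{A}$ and $B(t)\in\mathcal{B}$ for all $t\in\mathbb{Z}$. For $x_0\in\mathbb{F}^n$, initial time $t_0$ and input $u$, $\varphi(\cdot,t_0,x_0,u)$ denotes the unique solution on $\{t\in\mathbb{Z}: t\ge t_0\}$ with $\varphi(t_0,t_0,x_0,u)=x_0$; its value at $t$ depends only on $u$ restricted to $[t_0,t)$. Controllability: the system is controllable on the interval $[t_0,t_1]$ if for all $x_0,x_1\in\mathbb{F}^n$ there exists an input $u\colon[t_0,t_1)\to\mathbb{F}^r$ such that $x_1=\varphi(t_1,t_0,x_0,u)$. *)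

theory Defs
  imports Complex_Main
    "Jordan_Normal_Form.Matrix"
    "Graph_Theory.Pair_Digraph"
begin

section \<open>Nonzero patterns\<close>

text \<open>
  Matrices are those of \<^theory>\<open>Jordan_Normal_Form.Matrix\<close>, whose dimensions are natural numbers
  (possibly zero) and whose entries are indexed from \<open>0\<close>. A pattern is an equivalence class, i.e. a
  set of matrices.
\<close>

definition nz_rel :: "nat \<Rightarrow> nat \<Rightarrow> ('a::zero mat \<times> 'a mat) set" where
  "nz_rel p q = {(X, Y). X \<in> carrier_mat p q \<and> Y \<in> carrier_mat p q \<and>
     (\<forall>i<p. \<forall>j<q. X $$ (i, j) = 0 \<longleftrightarrow> Y $$ (i, j) = 0)}"

definition patterns :: "nat \<Rightarrow> nat \<Rightarrow> 'a::zero mat set set" where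
  "patterns p q = carrier_mat p q // nz_rel p q"

definition nz_class :: "'a::zero mat \<Rightarrow> 'a mat set" where
  "nz_class X = nz_rel (dim_row X) (dim_col X) `` {X}"

lemma equiv_nz_rel: "equiv (carrier_mat p q) (nz_rel p q)"
  by (rule equivI) (auto simp: nz_rel_def refl_on_def sym_def trans_def)

text \<open>The entry \<open>\<star>\<close>; on a pattern it does not matter which representative is inspected.\<close>

definition star_entry :: "'a::zero mat set \<Rightarrow> nat \<Rightarrow> nat \<Rightarrow> bool" where
  "star_entry P i j \<longleftrightarrow> (\<exists>X\<in>P. X $$ (i, j) \<noteq> 0)"

lemma star_entry_nz_class:
  assumes "i < dim_row X" "j < dim_col X"
  shows "star_entry (nz_class X) i j \<longleftrightarrow> X $$ (i, j) \<noteq> 0"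
  using assms by (auto simp: star_entry_def nz_class_def nz_rel_def)

section \<open>Block composition of patterns\<close>

text \<open>\<open>M \<times> L\<close> blocks, each of size \<open>h \<times> w\<close>; block rows and columns are numbered from \<open>0\<close>.\<close>

definition block_mat :: "nat \<Rightarrow> nat \<Rightarrow> nat \<Rightarrow> nat \<Rightarrow> (nat \<Rightarrow> nat \<Rightarrow> 'a mat) \<Rightarrow> 'a mat" where
  "block_mat M L h w X =
     mat (M * h) (L * w) (\<lambda>(k, l). X (k div h) (l div w) $$ (k mod h, l mod w))"

definition beside_mat :: "'a::zero mat \<Rightarrow> 'a mat \<Rightarrow> 'a mat" where
  "beside_mat X Y = four_block_mat X Y (0\<^sub>m 0 (dim_col X)) (0\<^sub>m 0 (dim_col Y))"

text \<open>
  Compositions of patterns are taken through representatives. As usual for operations on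
  equivalence classes, the union over all representatives is a union of equal classes.
\<close>

definition block_pattern ::
    "nat \<Rightarrow> nat \<Rightarrow> nat \<Rightarrow> nat \<Rightarrow> (nat \<Rightarrow> nat \<Rightarrow> 'a::zero mat set) \<Rightarrow> 'a mat set" where
  "block_pattern M L h w P =
     (\<Union>X\<in>{X. \<forall>i<M. \<forall>j<L. X i j \<in> P i j}. nz_class (block_mat M L h w X))"

definition beside_pattern :: "'a::zero mat set \<Rightarrow> 'a mat set \<Rightarrow> 'a mat set" where
  "beside_pattern P Q = (\<Union>X\<in>P. \<Union>Y\<in>Q. nz_class (beside_mat X Y))"

lemma nz_class_eqI:
  assumes "dim_row X = dim_row Y" "dim_col X = dim_col Y"
    and "\<And>i j. i < dim_row X \<Longrightarrow> j < dim_col X \<Longrightarrow> X $$ (i, j) = 0 \<longleftrightarrow> Y $$ (i, j) = 0"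
  shows "nz_class X = nz_class Y"
  using assms by (auto simp: nz_class_def nz_rel_def)

lemma nz_class_self: "X \<in> nz_class X"
  by (auto simp: nz_class_def nz_rel_def)

lemma mem_nz_class_iff:
  "Y \<in> nz_class X \<longleftrightarrow> dim_row Y = dim_row X \<and> dim_col Y = dim_col X \<and>
     (\<forall>i<dim_row X. \<forall>j<dim_col X. X $$ (i, j) = 0 \<longleftrightarrow> Y $$ (i, j) = 0)"
  by (auto simp: nz_class_def nz_rel_def)

lemma block_pattern_nz_class:
  assumes "\<And>i j. i < M \<Longrightarrow> j < L \<Longrightarrow> X i j \<in> carrier_mat h w"
  shows "block_pattern M L h w (\<lambda>i j. nz_class (X i j)) = nz_class (block_mat M L h w X)"
proof -
  have eq: "nz_class (block_mat M L h w Y) = nz_class (block_mat M L h w X)"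
    if Y: "\<forall>i<M. \<forall>j<L. Y i j \<in> nz_class (X i j)" for Y
  proof (rule nz_class_eqI)
    fix k l
    assume "k < dim_row (block_mat M L h w Y)" "l < dim_col (block_mat M L h w Y)"
    then have kl: "k < M * h" "l < L * w" by (auto simp: block_mat_def)
    then have pos: "0 < h" "0 < w" by (auto intro: Nat.gr0I)
    have "k div h < M" "l div w < L"
      using kl pos by (auto simp: less_mult_imp_div_less)
    moreover have "k mod h < h" "l mod w < w" using pos by auto
    ultimately have "X (k div h) (l div w) $$ (k mod h, l mod w) = 0 \<longleftrightarrow>
        Y (k div h) (l div w) $$ (k mod h, l mod w) = 0"
      using Y assms[of "k div h" "l div w"] unfolding mem_nz_class_iff by auto
    then show "block_mat M L h w Y $$ (k, l) = 0 \<longleftrightarrow> block_mat M L h w X $$ (k, l) = 0"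
      using kl by (simp add: block_mat_def)
  qed (auto simp: block_mat_def)
  show ?thesis
    unfolding block_pattern_def using eq nz_class_self by blast
qed

lemma beside_pattern_nz_class:
  assumes "dim_row X = dim_row Y"
  shows "beside_pattern (nz_class X) (nz_class Y) = nz_class (beside_mat X Y)"
proof -
  have eq: "nz_class (beside_mat X' Y') = nz_class (beside_mat X Y)"
    if "X' \<in> nz_class X" "Y' \<in> nz_class Y" for X' Y'
    using that assms unfolding mem_nz_class_iff
    by (intro nz_class_eqI) (auto simp: beside_mat_def)
  show ?thesis
    unfolding beside_pattern_def using eq nz_class_self by blast
qed

definition K_pattern ::
    "nat \<Rightarrow> nat \<Rightarrow> nat \<Rightarrow> 'a::{zero,one} mat set \<Rightarrow> 'a mat set \<Rightarrow> 'a mat set" where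
  "K_pattern n r N \<A> \<B> = beside_pattern
     (block_pattern N N n n
        (\<lambda>i j. if j = Suc i then nz_class (1\<^sub>m n)
               else if j = i \<and> 0 < i then \<A>
               else nz_class (0\<^sub>m n n)))
     (block_pattern N N n r
        (\<lambda>i j. if j = i then \<B> else nz_class (0\<^sub>m n r)))"

section \<open>The graph of a pattern\<close>

text \<open>Vertices are numbered from \<open>1\<close>, matrix entries from \<open>0\<close>.\<close>

definition pattern_graph :: "nat \<Rightarrow> nat \<Rightarrow> 'a::zero mat set \<Rightarrow> nat pair_pre_digraph" where
  "pattern_graph p q K =
     \<lparr> pverts = {1..q},
       parcs = {(v, w). v \<in> {1..q} \<and> w \<in> {1..p} \<and> star_entry K (w - 1) (v - 1)} \<rparr>"

definition cond_G3 :: "nat \<Rightarrow> nat \<Rightarrow> 'a::zero mat set \<Rightarrow> bool" where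
  "cond_G3 p q K \<longleftrightarrow>
     (\<forall>V. V \<noteq> {} \<and> V \<subseteq> {1..p} \<longrightarrow>
        (\<exists>v\<in>{1..q}. \<exists>!w. w \<in> V \<and> v \<rightarrow>\<^bsub>with_proj (pattern_graph p q K)\<^esub> w))"

section \<open>Discrete-time systems\<close>

definition of_pattern ::
    "'a mat set \<Rightarrow> 'a mat set \<Rightarrow> (int \<Rightarrow> 'a mat) \<Rightarrow> (int \<Rightarrow> 'a mat) \<Rightarrow> bool" where
  "of_pattern \<A> \<B> A B \<longleftrightarrow> (\<forall>t. A t \<in> \<A> \<and> B t \<in> \<B>)"

definition time_invariant :: "(int \<Rightarrow> 'a mat) \<Rightarrow> (int \<Rightarrow> 'a mat) \<Rightarrow> bool" where
  "time_invariant A B \<longleftrightarrow> (\<forall>s t. A s = A t \<and> B s = B t)"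

primrec state_after ::
    "(int \<Rightarrow> 'a::semiring_0 mat) \<Rightarrow> (int \<Rightarrow> 'a mat) \<Rightarrow> int \<Rightarrow> 'a vec \<Rightarrow> (int \<Rightarrow> 'a vec) \<Rightarrow> nat \<Rightarrow> 'a vec"
where
  "state_after A B t0 x0 u 0 = x0"
| "state_after A B t0 x0 u (Suc k) =
     A (t0 + int k) *\<^sub>v state_after A B t0 x0 u k + B (t0 + int k) *\<^sub>v u (t0 + int k)"

text \<open>The solution \<open>\<phi>(t, t0, x0, u)\<close>; only meaningful for \<open>t0 \<le> t\<close>.\<close>

definition phi ::
    "(int \<Rightarrow> 'a::semiring_0 mat) \<Rightarrow> (int \<Rightarrow> 'a mat) \<Rightarrow> int \<Rightarrow> int \<Rightarrow> 'a vec \<Rightarrow> (int \<Rightarrow> 'a vec) \<Rightarrow> 'a vec"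
where
  "phi A B t t0 x0 u = state_after A B t0 x0 u (nat (t - t0))"

lemma phi_initial: "phi A B t0 t0 x0 u = x0"
  by (simp add: phi_def)

lemma phi_step:
  assumes "t0 \<le> t"
  shows "phi A B (t + 1) t0 x0 u = A t *\<^sub>v phi A B t t0 x0 u + B t *\<^sub>v u t"
proof -
  have "nat (t + 1 - t0) = Suc (nat (t - t0))" using assms by simp
  then show ?thesis using assms by (simp add: phi_def)
qed

text \<open>
  Inputs are functions on all of \<open>\<int>\<close>, constrained only on \<open>[t0, t1)\<close>; the values elsewhere do not
  affect \<^term>\<open>phi A B t1 t0 x0 u\<close>.
\<close>

definition controllable ::
    "nat \<Rightarrow> nat \<Rightarrow> (int \<Rightarrow> 'a::semiring_0 mat) \<Rightarrow> (int \<Rightarrow> 'a mat) \<Rightarrow> int \<Rightarrow> int \<Rightarrow> bool" where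
  "controllable n r A B t0 t1 \<longleftrightarrow>
     (\<forall>x0\<in>carrier_vec n. \<forall>x1\<in>carrier_vec n.
        \<exists>u. (\<forall>t\<in>{t0..<t1}. u t \<in> carrier_vec r) \<and> x1 = phi A B t1 t0 x0 u)"

end

theory Submission
  imports Defs
begin

text \<open>
  A system fails to be controllable on \<open>[t0, t1]\<close> exactly when it has a nonzero costate: vectors
  \<open>p 0, \<dots>, p (N - 1)\<close> with \<open>p i = A\<^sup>T p (i + 1)\<close> and \<open>B\<^sup>T p i = 0\<close>, the coefficients being those of the
  respective step. Only the supports of the \<open>p i\<close> matter for a pattern: if a column of a matrix has exactly
  one nonzero entry in the rows of a set \<open>S\<close>, its product with a vector of support \<open>S\<close> cannot vanish,
  whereas with no or several such entries suitable values of the entries make it vanish. A set of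
  rows of \<open>\<K>\<close> that violates \<open>G\<^sub>3\<close> is thus a possible support of a costate. Such sets are called
  stalled below, and \<open>G\<^sub>3\<close> says that there are none (\<open>cond_G3_iff_no_stalled\<close>).

  If there is a stalled set, nonzero entries can be chosen such that the indicator functions of its
  slices form a costate (\<open>stalled_imp_uncontrollable\<close>). If there is none, controllability
  follows by elimination (\<open>no_stalled_imp_controllable\<close>): the equations of the trajectory, with both end
  points prescribed, are solved one at a time. Among the equations of a set \<open>V\<close> there is one
  that can be corrected by a variable which occurs in no other equation of \<open>V\<close>, so that the system
  is triangular after reordering.

  For time-invariant systems, the supports that come from left eigenvectors \<open>p\<close> of the system matrix
  for the eigenvalues \<open>0\<close> and \<open>1\<close> suffice. It remains to extract such a stationary support from a
  stalled set with at least \<open>n\<close> slices \<open>V 0, V 1, \<dots>\<close> (\<open>stalled_imp_stationary\<close>). If there were none,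
  every union of \<open>m\<close> consecutive nonempty slices would have at least \<open>m\<close> elements, because
  dropping the first or the last slice loses an element. Hence \<open>n\<close> slices exhaust all states, and
  dropping the last slice repeatedly peels off one state at a time until a single
  state \<open>w\<close> remains that no state influences, which makes \<open>{w}\<close> a stationary support after all.
\<close>

section \<open>Balanced sets of rows\<close>

text \<open>
  Combinatorial form of the solvability of \<open>Y\<^sup>T 1\<^sub>S = 1\<^sub>T\<close> by a matrix \<open>Y\<close> of the pattern of \<open>X\<close>: in
  column \<open>j\<close>, some number of nonzero summands, plus a further nonzero term if \<open>j \<in> T\<close>, have to
  cancel, which is impossible only for one term.
\<close>

definition balanced :: "'a::zero mat \<Rightarrow> nat set \<Rightarrow> nat set \<Rightarrow> bool" where
  "balanced X T S \<longleftrightarrow>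
     (\<forall>j<dim_col X. card {k\<in>S. X $$ (k, j) \<noteq> 0} + of_bool (j \<in> T) \<noteq> 1)"

text \<open>
  Equal summands have sum \<open>1\<close>; for sum \<open>0\<close>, one summand compensates for all others, which are ones.
  Characteristic \<open>0\<close> keeps these numbers from vanishing.
\<close>

lemma exists_nonzero_summands:
  fixes S :: "'b set"
  assumes "finite S" and "card S + of_bool b \<noteq> 1"
  shows "\<exists>f. (\<forall>k\<in>S. f k \<noteq> (0::'a::field_char_0)) \<and> sum f S = of_bool b"
proof (cases "S = {}")
  case True
  with assms show ?thesis by (auto simp: of_bool_def split: if_splits)
next
  case False
  then have pos: "card S > 0" using assms by (simp add: card_gt_0_iff)
  show ?thesis
  proof (cases b)
    case True
    then show ?thesis using pos by (intro exI[of _ "\<lambda>_. 1 / of_nat (card S)"]) auto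
  next
    case b: False
    obtain s where s: "s \<in> S" using False by blast
    define f :: "'b \<Rightarrow> 'a" where "f k = (if k = s then - of_nat (card (S - {s})) else 1)" for k
    have "card (S - {s}) \<noteq> 0" using assms b s pos by simp
    then have "(of_nat (card (S - {s})) :: 'a) \<noteq> 0" by (simp only: of_nat_eq_0_iff not_False_eq_True)
    then have "\<forall>k\<in>S. f k \<noteq> 0" unfolding f_def by simp
    moreover have "sum f S = f s + sum f (S - {s})" using assms s by (simp add: sum.remove)
    moreover have "sum f (S - {s}) = (\<Sum>k\<in>S - {s}. 1)" by (rule sum.cong) (auto simp: f_def)
    ultimately show ?thesis using b by (intro exI[of _ f]) (simp add: f_def)
  qed
qed

text \<open>
  All columns can be treated independently, and entries outside the rows \<open>S\<close> may be any nonzero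
  numbers.
\<close>

lemma balanced_realizable:
  fixes X :: "'a::field_char_0 mat"
  assumes X: "X \<in> carrier_mat p q" and S: "S \<subseteq> {..<p}" and "balanced X T S"
  shows "\<exists>Y\<in>nz_class X. \<forall>j<q. (\<Sum>k\<in>S. Y $$ (k, j)) = of_bool (j \<in> T)"
proof -
  have fin: "finite S" using S by (rule finite_subset) simp
  let ?Z = "\<lambda>j. {k\<in>S. X $$ (k, j) \<noteq> 0}"
  have "\<forall>j. \<exists>f. j < q \<longrightarrow> (\<forall>k\<in>?Z j. f k \<noteq> (0::'a)) \<and> sum f (?Z j) = of_bool (j \<in> T)"
  proof
    fix j
    show "\<exists>f. j < q \<longrightarrow> (\<forall>k\<in>?Z j. f k \<noteq> (0::'a)) \<and> sum f (?Z j) = of_bool (j \<in> T)"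
    proof (cases "j < q")
      case True
      then have "card (?Z j) + of_bool (j \<in> T) \<noteq> 1" using assms(3) X by (simp add: balanced_def)
      moreover have "finite (?Z j)" using fin by simp
      ultimately have "\<exists>f. (\<forall>k\<in>?Z j. f k \<noteq> (0::'a)) \<and> sum f (?Z j) = of_bool (j \<in> T)"
        by (intro exists_nonzero_summands)
      then show ?thesis by blast
    qed simp
  qed
  then obtain f where f: "\<forall>j. j < q \<longrightarrow>
      (\<forall>k\<in>?Z j. f j k \<noteq> (0::'a)) \<and> sum (f j) (?Z j) = of_bool (j \<in> T)"
    unfolding choice_iff by blast
  define Y where "Y = mat p q (\<lambda>(k, j). if X $$ (k, j) = 0 then 0 else if k \<in> S then f j k else 1)"
  show ?thesis
  proof (intro bexI allI impI)
    show "Y \<in> nz_class X" using f X by (auto simp: mem_nz_class_iff Y_def)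
  next
    fix j assume j: "j < q"
    have "(\<Sum>k\<in>S. Y $$ (k, j)) = (\<Sum>k\<in>S. if X $$ (k, j) \<noteq> 0 then f j k else 0)"
      using j S by (intro sum.cong) (auto simp: Y_def)
    also have "\<dots> = sum (f j) (?Z j)" using fin by (simp add: sum.If_cases Collect_conj_eq)
    finally show "(\<Sum>k\<in>S. Y $$ (k, j)) = of_bool (j \<in> T)" using f j by simp
  qed
qed

text \<open>
  A unique nonzero entry in the union would be the unique one in each member that contains its row.
\<close>

lemma balanced_UN:
  assumes "\<And>i. i \<in> I \<Longrightarrow> balanced X {} (S i)"
  shows "balanced X {} (\<Union>i\<in>I. S i)"
  unfolding balanced_def
proof (intro allI impI)
  fix j assume j: "j < dim_col X"
  have "card {k\<in>\<Union>i\<in>I. S i. X $$ (k, j) \<noteq> 0} \<noteq> 1"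
  proof
    assume "card {k\<in>\<Union>i\<in>I. S i. X $$ (k, j) \<noteq> 0} = 1"
    then obtain w where w: "{k\<in>\<Union>i\<in>I. S i. X $$ (k, j) \<noteq> 0} = {w}" by (rule card_1_singletonE)
    then obtain i where i: "i \<in> I" "w \<in> S i" by blast
    then have "{k\<in>S i. X $$ (k, j) \<noteq> 0} = {w}" using w by blast
    then show False using assms[OF i(1)] j by (auto simp: balanced_def)
  qed
  then show "card {k\<in>\<Union>i\<in>I. S i. X $$ (k, j) \<noteq> 0} + of_bool (j \<in> {}) \<noteq> 1" by simp
qed

section \<open>Stalled sets\<close>

text \<open>
  A pair \<open>(i, k)\<close> stands for row \<open>k\<close> of block row \<open>i\<close> of \<open>\<K>\<close>, that is, for the equation of the state component
  \<open>k\<close> at step \<open>i\<close>. The slice \<open>G `` {i}\<close> is the support of the costate at this step.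
\<close>

definition stalled :: "'a::zero mat \<Rightarrow> 'a mat \<Rightarrow> nat \<Rightarrow> (nat \<times> nat) set \<Rightarrow> bool" where
  "stalled A B N G \<longleftrightarrow> G \<subseteq> {..<N} \<times> {..<dim_row A} \<and> G \<noteq> {} \<and>
     (\<forall>i. Suc i < N \<longrightarrow> balanced A (G `` {i}) (G `` {Suc i})) \<and>
     (\<forall>i<N. balanced B {} (G `` {i}))"

text \<open>
  The arcs of \<open>\<G>(\<K>)\<close> in block coordinates. \<open>Inl (i, j)\<close> is component \<open>j\<close> of the state after step \<open>i\<close>, which
  occurs on the left-hand side at step \<open>i\<close> and on the right-hand side at step \<open>i + 1\<close>; \<open>Inr (i, j)\<close> is component
  \<open>j\<close> of the input at step \<open>i\<close>.
\<close>

fun grid_arc :: "'a::zero mat \<Rightarrow> 'a mat \<Rightarrow> (nat \<times> nat) + (nat \<times> nat) \<Rightarrow> nat \<times> nat \<Rightarrow> bool" where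
  "grid_arc A B (Inl (i, j)) (i', k) \<longleftrightarrow> i' = i \<and> k = j \<or> i' = Suc i \<and> A $$ (k, j) \<noteq> 0"
| "grid_arc A B (Inr (i, j)) (i', k) \<longleftrightarrow> i' = i \<and> B $$ (k, j) \<noteq> 0"

text \<open>
  The state before the first and the one after the last step are prescribed. They are not among the
  unknowns; in \<open>\<K>\<close>, the former is the zero block column.
\<close>

definition grid_cols :: "nat \<Rightarrow> nat \<Rightarrow> nat \<Rightarrow> ((nat \<times> nat) + (nat \<times> nat)) set" where
  "grid_cols n r N = Inl ` ({i. Suc i < N} \<times> {..<n}) \<union> Inr ` ({..<N} \<times> {..<r})"

lemma ex1_iff_card_Collect: "(\<exists>!w. P w) \<longleftrightarrow> card {w. P w} = 1"
proof
  assume "\<exists>!w. P w"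
  then obtain w where "{w. P w} = {w}" by auto
  then show "card {w. P w} = 1" by simp
next
  assume "card {w. P w} = 1"
  then obtain w where "{w. P w} = {w}" by (rule card_1_singletonE)
  then show "\<exists>!w. P w" by (metis mem_Collect_eq singleton_iff)
qed

lemma card_arcs_state:
  assumes "finite G"
  shows "card {w. w \<in> G \<and> grid_arc A B (Inl (i, j)) w} =
    card {k \<in> G `` {Suc i}. A $$ (k, j) \<noteq> 0} + of_bool (j \<in> G `` {i})"
proof -
  let ?S = "{k \<in> G `` {Suc i}. A $$ (k, j) \<noteq> 0}"
  have "finite (G `` {Suc i})" using assms by (rule finite_Image)
  then have fin: "finite ?S" by (rule rev_finite_subset) auto
  have eq: "{w. w \<in> G \<and> grid_arc A B (Inl (i, j)) w} =
      Pair (Suc i) ` ?S \<union> (if j \<in> G `` {i} then {(i, j)} else {})"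
    by auto
  have "card (Pair (Suc i) ` ?S) = card ?S" by (rule card_image) (simp add: inj_on_def)
  then show ?thesis unfolding eq using fin by (subst card_Un_disjoint) auto
qed

lemma card_arcs_input:
  "card {w. w \<in> G \<and> grid_arc A B (Inr (i, j)) w} = card {k \<in> G `` {i}. B $$ (k, j) \<noteq> 0}"
proof -
  have "{w. w \<in> G \<and> grid_arc A B (Inr (i, j)) w} = Pair i ` {k \<in> G `` {i}. B $$ (k, j) \<noteq> 0}"
    by auto
  then show ?thesis by (simp add: card_image inj_on_def)
qed

text \<open>
  In the column of \<open>Inl (i, j)\<close>, the two summands in the definition of a balanced set count the nonzero
  entries of the system matrix and of the identity block above it.
\<close>

lemma stalled_iff_no_unique_arc:
  assumes "A \<in> carrier_mat n n" "B \<in> carrier_mat n r"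
    and "G \<subseteq> {..<N} \<times> {..<n}" "G \<noteq> {}"
  shows "stalled A B N G \<longleftrightarrow> \<not> (\<exists>v\<in>grid_cols n r N. \<exists>!w. w \<in> G \<and> grid_arc A B v w)"
proof -
  have fin: "finite G" using assms(3) by (rule finite_subset) simp
  have "(\<exists>v\<in>grid_cols n r N. \<exists>!w. w \<in> G \<and> grid_arc A B v w) \<longleftrightarrow>
      (\<exists>i j. Suc i < N \<and> j < n \<and>
         card {k \<in> G `` {Suc i}. A $$ (k, j) \<noteq> 0} + of_bool (j \<in> G `` {i}) = 1) \<or>
      (\<exists>i j. i < N \<and> j < r \<and> card {k \<in> G `` {i}. B $$ (k, j) \<noteq> 0} = 1)"
    unfolding ex1_iff_card_Collect grid_cols_def bex_Un bex_simps(7)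
    by (simp only: Bex_def mem_Sigma_iff split_paired_Ex card_arcs_state[OF fin] card_arcs_input
        mem_Collect_eq lessThan_iff conj_assoc)
  then show ?thesis
    using assms unfolding stalled_def balanced_def by auto
qed

section \<open>Condition G3 as absence of stalled sets\<close>

lemma K_pattern_nz_class:
  fixes A B :: "'a::zero_neq_one mat"
  assumes A: "A \<in> carrier_mat n n" and B: "B \<in> carrier_mat n r"
  shows "K_pattern n r N (nz_class A) (nz_class B) = nz_class (beside_mat
     (block_mat N N n n (\<lambda>i j. if j = Suc i then 1\<^sub>m n else if j = i \<and> 0 < i then A else 0\<^sub>m n n))
     (block_mat N N n r (\<lambda>i j. if j = i then B else 0\<^sub>m n r)))"
proof -
  have eA: "(\<lambda>i j. if j = Suc i then nz_class (1\<^sub>m n) else if j = i \<and> 0 < i then nz_class A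
        else nz_class (0\<^sub>m n n)) =
      (\<lambda>i j. nz_class (if j = Suc i then 1\<^sub>m n else if j = i \<and> 0 < i then A else 0\<^sub>m n n))"
    and eB: "(\<lambda>i j. if j = i then nz_class B else nz_class (0\<^sub>m n r)) =
      (\<lambda>i j. nz_class (if j = i then B else 0\<^sub>m n r))"
    by (auto intro!: ext)
  show ?thesis
    unfolding K_pattern_def eA eB using A B
    by (subst (1 2) block_pattern_nz_class)
      (auto intro!: beside_pattern_nz_class simp: block_mat_def)
qed

text \<open>The vertex numbers in \<open>\<G>(\<K>)\<close> start from \<open>1\<close>, the block coordinates from \<open>0\<close>.\<close>

definition flat_row :: "nat \<Rightarrow> nat \<times> nat \<Rightarrow> nat" where
  "flat_row n = (\<lambda>(i, k). Suc (i * n + k))"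

fun flat_col :: "nat \<Rightarrow> nat \<Rightarrow> nat \<Rightarrow> (nat \<times> nat) + (nat \<times> nat) \<Rightarrow> nat" where
  "flat_col n r N (Inl (i, j)) = Suc (Suc i * n + j)"
| "flat_col n r N (Inr (i, j)) = Suc (N * n + (i * r + j))"

lemma block_index_less: "i * n + k < N * n" if "i < N" "k < n" for i n k N :: nat
proof -
  have "i * n + k < Suc i * n" using that by simp
  also have "\<dots> \<le> N * n" using that by (intro mult_le_mono1) simp
  finally show ?thesis .
qed

lemma flat_row_image: "flat_row n ` ({..<N} \<times> {..<n}) = {1..n * N}"
proof
  show "flat_row n ` ({..<N} \<times> {..<n}) \<subseteq> {1..n * N}"
    using block_index_less[of _ N _ n] by (auto simp: flat_row_def Suc_le_eq mult.commute)
  show "{1..n * N} \<subseteq> flat_row n ` ({..<N} \<times> {..<n})"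
  proof
    fix w assume w: "w \<in> {1..n * N}"
    then have n: "n > 0" by (auto intro: Nat.gr0I)
    have "w = flat_row n ((w - 1) div n, (w - 1) mod n)" using w by (simp add: flat_row_def)
    moreover have "(w - 1) div n < N" using w by (intro less_mult_imp_div_less) (auto simp: mult.commute)
    ultimately show "w \<in> flat_row n ` ({..<N} \<times> {..<n})" using n by (auto intro: rev_image_eqI)
  qed
qed

lemma inj_flat_row: "inj_on (flat_row n) ({..<N} \<times> {..<n})"
proof (rule inj_onI, clarsimp simp: flat_row_def)
  fix i k i' k' assume k: "k < n" "k' < n" and e: "i * n + k = i' * n + k'"
  have "(i * n + k) div n = i" "(i' * n + k') div n = i'" using k by auto
  then have "i = i'" using e by metis
  with e show "i = i' \<and> k = k'" by simp
qed

lemma flat_col_image: "{1..(n + r) * N} \<subseteq> {1..n} \<union> flat_col n r N ` grid_cols n r N"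
  and flat_col_in: "v \<in> grid_cols n r N \<Longrightarrow> flat_col n r N v \<in> {1..(n + r) * N}"
proof -
  show "{1..(n + r) * N} \<subseteq> {1..n} \<union> flat_col n r N ` grid_cols n r N"
  proof
    fix v assume v: "v \<in> {1..(n + r) * N}"
    consider "v \<le> n" | "n < v" "v \<le> N * n" | "N * n < v" by linarith
    then show "v \<in> {1..n} \<union> flat_col n r N ` grid_cols n r N"
    proof cases
      case 1 then show ?thesis using v by simp
    next
      case 2
      then have n: "n > 0" by (auto intro: Nat.gr0I)
      let ?i = "(v - 1) div n" and ?j = "(v - 1) mod n"
      have i: "?i < N" using 2 by (intro less_mult_imp_div_less) auto
      have "n div n \<le> ?i" using 2 by (intro div_le_mono) auto
      then obtain i where i': "?i = Suc i" using n by (metis div_self less_not_refl not0_implies_Suc not_one_le_zero)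
      have "v = flat_col n r N (Inl (i, ?j))"
        using 2 div_mult_mod_eq[of "v - 1" n] unfolding i' by simp
      moreover have "Inl (i, ?j) \<in> grid_cols n r N" using i i' n by (auto simp: grid_cols_def)
      ultimately show ?thesis by blast
    next
      case 3
      let ?u = "v - 1 - N * n"
      have u: "?u < N * r" using 3 v by (auto simp: algebra_simps)
      then have r: "r > 0" by (auto intro: Nat.gr0I)
      have "v = flat_col n r N (Inr (?u div r, ?u mod r))" using 3 by simp
      moreover have "Inr (?u div r, ?u mod r) \<in> grid_cols n r N"
        using u r by (auto simp: grid_cols_def less_mult_imp_div_less)
      ultimately show ?thesis by blast
    qed
  qed
next
  assume "v \<in> grid_cols n r N"
  then consider i j where "v = Inl (i, j)" "Suc i < N" "j < n" | i j where "v = Inr (i, j)" "i < N" "j < r"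
    by (auto simp: grid_cols_def)
  then show "flat_col n r N v \<in> {1..(n + r) * N}"
  proof cases
    case 1 then show ?thesis using block_index_less[of "Suc i" N j n] by (simp add: algebra_simps)
  next
    case 2 then show ?thesis using block_index_less[of i N j r] by (simp add: algebra_simps)
  qed
qed

lemma K_arc_iff:
  fixes A B :: "'a::zero_neq_one mat"
  assumes A: "A \<in> carrier_mat n n" and B: "B \<in> carrier_mat n r"
    and ik: "i < N" "k < n"
  defines "E \<equiv> \<lambda>v w. v \<rightarrow>\<^bsub>with_proj (pattern_graph (n * N) ((n + r) * N)
                          (K_pattern n r N (nz_class A) (nz_class B)))\<^esub> w"
  shows "v \<in> grid_cols n r N \<Longrightarrow> E (flat_col n r N v) (flat_row n (i, k)) \<longleftrightarrow> grid_arc A B v (i, k)"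
    and "1 \<le> c \<Longrightarrow> c \<le> n \<Longrightarrow> \<not> E c (flat_row n (i, k))"
proof -
  let ?KA = "block_mat N N n n (\<lambda>i j. if j = Suc i then 1\<^sub>m n else if j = i \<and> 0 < i then A else 0\<^sub>m n n)"
  let ?KB = "block_mat N N n r (\<lambda>i j. if j = i then B else 0\<^sub>m n r)"
  have w: "i * n + k < N * n" using ik by (rule block_index_less)
  have E: "E c (flat_row n (i, k)) \<longleftrightarrow> beside_mat ?KA ?KB $$ (i * n + k, c - 1) \<noteq> 0"
    if "c \<in> {1..(n + r) * N}" for c
  proof -
    have "flat_row n (i, k) \<in> {1..n * N}" using flat_row_image[of n N] ik by blast
    moreover have "i * n + k < dim_row (beside_mat ?KA ?KB)" "c - 1 < dim_col (beside_mat ?KA ?KB)"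
      using w that by (auto simp: beside_mat_def block_mat_def algebra_simps)
    ultimately show ?thesis
      using that unfolding E_def K_pattern_nz_class[OF A B]
      by (simp add: pattern_graph_def star_entry_nz_class flat_row_def)
  qed
  have KA: "beside_mat ?KA ?KB $$ (i * n + k, i' * n + j) \<noteq> 0 \<longleftrightarrow>
      i' = Suc i \<and> k = j \<or> i' = i \<and> 0 < i \<and> A $$ (k, j) \<noteq> 0" if "i' < N" "j < n" for i' j
    using that w block_index_less[OF that] ik by (auto simp: beside_mat_def block_mat_def)
  have KB: "beside_mat ?KA ?KB $$ (i * n + k, N * n + (i' * r + j)) \<noteq> 0 \<longleftrightarrow>
      i' = i \<and> B $$ (k, j) \<noteq> 0" if "i' < N" "j < r" for i' j
    using that w block_index_less[OF that] ik by (auto simp: beside_mat_def block_mat_def)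
  show "E (flat_col n r N v) (flat_row n (i, k)) \<longleftrightarrow> grid_arc A B v (i, k)"
    if v: "v \<in> grid_cols n r N"
  proof -
    from v consider i' j where "v = Inl (i', j)" "Suc i' < N" "j < n"
      | i' j where "v = Inr (i', j)" "i' < N" "j < r"
      by (auto simp: grid_cols_def)
    then show ?thesis
    proof cases
      case 1 then show ?thesis using E[OF flat_col_in[OF v]] KA[of "Suc i'" j] by auto
    next
      case 2 then show ?thesis using E[OF flat_col_in[OF v]] KB[of i' j] by auto
    qed
  qed
  show "\<not> E c (flat_row n (i, k))" if "1 \<le> c" "c \<le> n"
  proof -
    have "n \<le> (n + r) * N" using ik by (cases N) (simp_all add: algebra_simps)
    then have "c \<in> {1..(n + r) * N}" using that by simp
    then show ?thesis using E[of c] KA[of 0 "c - 1"] that ik by auto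
  qed
qed

lemma cond_G3_iff_no_stalled:
  fixes A B :: "'a::zero_neq_one mat"
  assumes A: "A \<in> carrier_mat n n" and B: "B \<in> carrier_mat n r"
  shows "cond_G3 (n * N) ((n + r) * N) (K_pattern n r N (nz_class A) (nz_class B)) \<longleftrightarrow>
    (\<nexists>G. stalled A B N G)"
proof -
  let ?W = "{..<N} \<times> {..<n}"
  define E where "E = (\<lambda>v w. v \<rightarrow>\<^bsub>with_proj (pattern_graph (n * N) ((n + r) * N)
                          (K_pattern n r N (nz_class A) (nz_class B)))\<^esub> w)"
  have arc: "(\<exists>v\<in>{1..(n + r) * N}. \<exists>!w. w \<in> flat_row n ` G \<and> E v w) \<longleftrightarrow>
      (\<exists>v\<in>grid_cols n r N. \<exists>!w. w \<in> G \<and> grid_arc A B v w)" if G: "G \<subseteq> ?W" for G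
  proof -
    have inj: "inj_on (flat_row n) G" using inj_flat_row G by (rule inj_on_subset)
    have col: "(\<exists>!w. w \<in> flat_row n ` G \<and> E (flat_col n r N v) w) \<longleftrightarrow>
        (\<exists>!w. w \<in> G \<and> grid_arc A B v w)" if v: "v \<in> grid_cols n r N" for v
    proof -
      have "E (flat_col n r N v) (flat_row n w) \<longleftrightarrow> grid_arc A B v w" if "w \<in> G" for w
        using K_arc_iff(1)[OF A B _ _ v] that G unfolding E_def by (cases w) blast
      then have "{w. w \<in> flat_row n ` G \<and> E (flat_col n r N v) w} =
          flat_row n ` {w. w \<in> G \<and> grid_arc A B v w}"
        by auto
      moreover have "card (flat_row n ` {w. w \<in> G \<and> grid_arc A B v w}) =
          card {w. w \<in> G \<and> grid_arc A B v w}"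
        using inj by (intro card_image) (auto intro: inj_on_subset)
      ultimately show ?thesis by (simp add: ex1_iff_card_Collect)
    qed
    have "\<not> E c w" if "c \<in> {1..n}" "w \<in> flat_row n ` G" for c w
    proof -
      obtain i k where "w = flat_row n (i, k)" "i < N" "k < n" using \<open>w \<in> _\<close> G by auto
      then show ?thesis using K_arc_iff(2)[OF A B, of i N k c] \<open>c \<in> _\<close> unfolding E_def by simp
    qed
    then have pre: "v \<in> flat_col n r N ` grid_cols n r N"
      if "v \<in> {1..(n + r) * N}" "\<exists>!w. w \<in> flat_row n ` G \<and> E v w" for v
      using that flat_col_image[of n r N] by blast
    show ?thesis
    proof
      assume "\<exists>v\<in>{1..(n + r) * N}. \<exists>!w. w \<in> flat_row n ` G \<and> E v w"
      then obtain v where v: "v \<in> {1..(n + r) * N}" "\<exists>!w. w \<in> flat_row n ` G \<and> E v w" ..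
      obtain v' where "v = flat_col n r N v'" "v' \<in> grid_cols n r N" using pre[OF v] ..
      then show "\<exists>v\<in>grid_cols n r N. \<exists>!w. w \<in> G \<and> grid_arc A B v w"
        using v(2) col by (intro bexI[of _ v']) simp_all
    next
      assume "\<exists>v\<in>grid_cols n r N. \<exists>!w. w \<in> G \<and> grid_arc A B v w"
      then obtain v where v: "v \<in> grid_cols n r N" "\<exists>!w. w \<in> G \<and> grid_arc A B v w" ..
      then show "\<exists>v\<in>{1..(n + r) * N}. \<exists>!w. w \<in> flat_row n ` G \<and> E v w"
        using col[OF v(1)] flat_col_in[OF v(1)] by (intro bexI[of _ "flat_col n r N v"]) simp_all
    qed
  qed
  have key: "(\<exists>v\<in>{1..(n + r) * N}. \<exists>!w. w \<in> flat_row n ` G \<and> E v w) \<longleftrightarrow> \<not> stalled A B N G"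
    if "G \<subseteq> ?W" "G \<noteq> {}" for G
    using arc[OF that(1)] stalled_iff_no_unique_arc[OF A B that] by simp
  have "cond_G3 (n * N) ((n + r) * N) (K_pattern n r N (nz_class A) (nz_class B)) \<longleftrightarrow>
      (\<forall>F\<subseteq>flat_row n ` ?W. F \<noteq> {} \<longrightarrow> (\<exists>v\<in>{1..(n + r) * N}. \<exists>!w. w \<in> F \<and> E v w))"
    unfolding cond_G3_def E_def flat_row_image by blast
  also have "\<dots> \<longleftrightarrow>
      (\<forall>G\<subseteq>?W. G \<noteq> {} \<longrightarrow> (\<exists>v\<in>{1..(n + r) * N}. \<exists>!w. w \<in> flat_row n ` G \<and> E v w))"
    unfolding all_subset_image by simp
  also have "\<dots> \<longleftrightarrow> (\<forall>G\<subseteq>?W. G \<noteq> {} \<longrightarrow> \<not> stalled A B N G)"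
    by (intro iff_allI imp_cong refl key)
  also have "\<dots> \<longleftrightarrow> (\<nexists>G. stalled A B N G)"
    using A by (auto simp: stalled_def)
  finally show ?thesis .
qed

section \<open>Uncontrollable systems from stalled sets\<close>

text \<open>
  The indicator functions of the sets \<open>S i\<close> form a costate, so the sum of the components in \<open>S i\<close> of the
  state after step \<open>i\<close> is invariant. Starting from \<open>0\<close> it remains \<open>0\<close> whatever the input, and a unit
  vector for an element of \<open>S (N - 1)\<close> is out of reach.
\<close>

lemma not_controllable_if_costate:
  fixes A B :: "int \<Rightarrow> 'a::field mat"
  assumes A: "\<And>t. A t \<in> carrier_mat n n" and B: "\<And>t. B t \<in> carrier_mat n r"
    and N: "N = nat (t1 - t0)" "t0 < t1"
    and S: "\<And>i. i < N \<Longrightarrow> S i \<subseteq> {..<n}" and last: "S (N - 1) \<noteq> {}"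
    and SA: "\<And>i j. Suc i < N \<Longrightarrow> j < n \<Longrightarrow>
      (\<Sum>k\<in>S (Suc i). A (t0 + int (Suc i)) $$ (k, j)) = of_bool (j \<in> S i)"
    and SB: "\<And>i j. i < N \<Longrightarrow> j < r \<Longrightarrow> (\<Sum>k\<in>S i. B (t0 + int i) $$ (k, j)) = 0"
  shows "\<not> controllable n r A B t0 t1"
proof
  assume contr: "controllable n r A B t0 t1"
  obtain w where w: "w \<in> S (N - 1)" using last by blast
  have N1: "N - 1 < N" "Suc (N - 1) = N" using N by auto
  have "unit_vec n w \<in> carrier_vec n" "(0\<^sub>v n :: 'a vec) \<in> carrier_vec n" by auto
  then obtain u where u: "\<And>t. t \<in> {t0..<t1} \<Longrightarrow> u t \<in> carrier_vec r"
    and x1: "unit_vec n w = phi A B t1 t0 (0\<^sub>v n) u"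
    using contr unfolding controllable_def by meson
  define x where "x = state_after A B t0 (0\<^sub>v n) u"
  have uc: "u (t0 + int i) \<in> carrier_vec r" if "i < N" for i using that N by (intro u) auto
  have x: "x i \<in> carrier_vec n" if "i \<le> N" for i
    using that
  proof (induction i)
    case (Suc i)
    then show ?case using A[of "t0 + int i"] B[of "t0 + int i"] uc[of i] by (auto simp: x_def)
  qed (simp add: x_def)
  have mv: "(\<Sum>k\<in>T. (M *\<^sub>v y) $ k) = (\<Sum>j<m. (\<Sum>k\<in>T. M $$ (k, j)) * y $ j)"
    if "M \<in> carrier_mat n m" "y \<in> carrier_vec m" "T \<subseteq> {..<n}" for M :: "'a mat" and y m T
  proof -
    have "(\<Sum>k\<in>T. (M *\<^sub>v y) $ k) = (\<Sum>k\<in>T. \<Sum>j<m. M $$ (k, j) * y $ j)"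
      using that by (intro sum.cong) (auto simp: scalar_prod_def atLeast0LessThan intro!: sum.cong)
    also have "\<dots> = (\<Sum>j<m. \<Sum>k\<in>T. M $$ (k, j) * y $ j)" by (rule sum.swap)
    finally show ?thesis by (simp add: sum_distrib_right)
  qed
  have step: "(\<Sum>k\<in>S i. x (Suc i) $ k) = (\<Sum>j<n. (\<Sum>k\<in>S i. A (t0 + int i) $$ (k, j)) * x i $ j)"
    if i: "i < N" for i
  proof -
    let ?M = "A (t0 + int i)" and ?L = "B (t0 + int i)" and ?u = "u (t0 + int i)"
    have "(\<Sum>k\<in>S i. x (Suc i) $ k) = (\<Sum>k\<in>S i. (?M *\<^sub>v x i) $ k + (?L *\<^sub>v ?u) $ k)"
      using S[OF i] A[of "t0 + int i"] B[of "t0 + int i"] uc[OF i] by (intro sum.cong) (auto simp: x_def)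
    also have "\<dots> = (\<Sum>k\<in>S i. (?M *\<^sub>v x i) $ k) + (\<Sum>k\<in>S i. (?L *\<^sub>v ?u) $ k)"
      by (rule sum.distrib)
    finally show ?thesis
      using mv[OF A x[of i] S[OF i], of "t0 + int i"] mv[OF B uc[OF i] S[OF i], of "t0 + int i"] SB[OF i] i
      by simp
  qed
  have "(\<Sum>k\<in>S i. x (Suc i) $ k) = 0" if "i < N" for i
    using that
  proof (induction i)
    case 0
    show ?case using step[OF 0] by (simp add: x_def)
  next
    case (Suc i)
    have "(\<Sum>k\<in>S (Suc i). x (Suc (Suc i)) $ k) = (\<Sum>j<n. of_bool (j \<in> S i) * x (Suc i) $ j)"
      using step[OF Suc.prems] SA[OF Suc.prems] by simp
    also have "\<dots> = (\<Sum>j\<in>S i. x (Suc i) $ j)"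
      using S[of i] Suc.prems by (intro sum.mono_neutral_cong_right) auto
    finally show ?case using Suc by simp
  qed
  from this[OF N1(1)] have "(\<Sum>k\<in>S (N - 1). unit_vec n w $ k :: 'a) = 0"
    using x1 N1(2) N(1) by (simp add: x_def phi_def)
  moreover have "(\<Sum>k\<in>S (N - 1). unit_vec n w $ k :: 'a) = (\<Sum>k\<in>S (N - 1). of_bool (k = w))"
    using S[OF N1(1)] w by (intro sum.cong) (auto simp: unit_vec_def)
  moreover have "finite (S (N - 1))" using S[OF N1(1)] finite_subset by blast
  ultimately show False using w by (simp add: of_bool_def)
qed

text \<open>If \<open>S'\<close> were empty, an element of \<open>S\<close> would be a single term with nothing to cancel it.\<close>

lemma balanced_nonempty_step:
  assumes "balanced A S S'" "S \<subseteq> {..<dim_col A}" "S \<noteq> {}"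
  shows "S' \<noteq> {}"
  using assms by (auto simp: balanced_def)

lemma nz_class_carrier: "Y \<in> nz_class X \<Longrightarrow> X \<in> carrier_mat p q \<Longrightarrow> Y \<in> carrier_mat p q"
  by (auto simp: mem_nz_class_iff)

lemma stalled_slice_subset:
  assumes "stalled A B N G"
  shows "G `` {i} \<subseteq> {..<dim_row A}"
  using assms by (auto simp: stalled_def)

lemma stalled_slice_nonempty_step:
  assumes "stalled A B N G" "A \<in> carrier_mat n n" "Suc i < N" "G `` {i} \<noteq> {}"
  shows "G `` {Suc i} \<noteq> {}"
proof (rule balanced_nonempty_step)
  show "balanced A (G `` {i}) (G `` {Suc i})" using assms by (simp add: stalled_def)
  show "G `` {i} \<subseteq> {..<dim_col A}" using stalled_slice_subset[OF assms(1)] assms(2) by auto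
qed (fact assms)

lemma stalled_imp_uncontrollable:
  fixes A B :: "'a::field_char_0 mat"
  assumes A: "A \<in> carrier_mat n n" and B: "B \<in> carrier_mat n r"
    and N: "N = nat (t1 - t0)" "t0 < t1" and G: "stalled A B N G"
  shows "\<exists>MA MB. of_pattern (nz_class A) (nz_class B) MA MB \<and> \<not> controllable n r MA MB t0 t1"
proof -
  let ?S = "\<lambda>i. G `` {i}"
  have sub: "?S i \<subseteq> {..<n}" for i using stalled_slice_subset[OF G] A by auto
  have "\<exists>Y\<in>nz_class A. Suc i < N \<longrightarrow> (\<forall>j<n. (\<Sum>k\<in>?S (Suc i). Y $$ (k, j)) = of_bool (j \<in> ?S i))" for i
  proof (cases "Suc i < N")
    case True
    then have "balanced A (?S i) (?S (Suc i))" using G by (simp add: stalled_def)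
    then show ?thesis using balanced_realizable[OF A sub] by blast
  qed (use nz_class_self in auto)
  then obtain YA where YA: "\<And>i. YA i \<in> nz_class A"
    "\<And>i j. Suc i < N \<Longrightarrow> j < n \<Longrightarrow> (\<Sum>k\<in>?S (Suc i). YA i $$ (k, j)) = of_bool (j \<in> ?S i)"
    by metis
  have "\<exists>Y\<in>nz_class B. i < N \<longrightarrow> (\<forall>j<r. (\<Sum>k\<in>?S i. Y $$ (k, j)) = 0)" for i
  proof (cases "i < N")
    case True
    then have "balanced B {} (?S i)" using G by (simp add: stalled_def)
    then show ?thesis using balanced_realizable[OF B sub, of "{}" i] by auto
  qed (use nz_class_self in auto)
  then obtain YB where YB: "\<And>i. YB i \<in> nz_class B"
    "\<And>i j. i < N \<Longrightarrow> j < r \<Longrightarrow> (\<Sum>k\<in>?S i. YB i $$ (k, j)) = 0"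
    by metis
  obtain i0 where i0: "i0 < N" "?S i0 \<noteq> {}" using G by (auto simp: stalled_def)
  have "i0 \<le> i \<Longrightarrow> i < N \<Longrightarrow> ?S i \<noteq> {}" for i
  proof (induction i rule: dec_induct)
    case (step i)
    then show ?case using stalled_slice_nonempty_step[OF G A, of i] by simp
  qed (use i0 in simp)
  then have last: "?S (N - 1) \<noteq> {}" using i0 by simp
  \<comment> \<open>\<open>YA i\<close> links the slices \<open>i\<close> and \<open>i + 1\<close> and therefore acts at step \<open>i + 1\<close>.\<close>
  let ?MA = "\<lambda>t. YA (nat (t - t0) - 1)" and ?MB = "\<lambda>t. YB (nat (t - t0))"
  have "\<not> controllable n r ?MA ?MB t0 t1"
    using sub last YA(2) YB(2)
    by (intro not_controllable_if_costate[where S = ?S, OF _ _ N])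
      (simp_all add: nz_class_carrier[OF YA(1) A] nz_class_carrier[OF YB(1) B] nat_add_distrib)
  moreover have "of_pattern (nz_class A) (nz_class B) ?MA ?MB"
    using YA(1) YB(1) by (simp add: of_pattern_def)
  ultimately show ?thesis by blast
qed

text \<open>
  The column sums over \<open>S\<close> are those of a left eigenvector \<open>1\<^sub>S\<close> for the eigenvalue \<open>0\<close> or \<open>1\<close>. The costate is
  \<open>1\<^sub>S\<close> at the last step; at all earlier steps it is \<open>0\<close> or \<open>1\<^sub>S\<close>, respectively.
\<close>

lemma balanced_imp_time_invariant_uncontrollable:
  fixes A B :: "'a::field_char_0 mat"
  assumes A: "A \<in> carrier_mat n n" and B: "B \<in> carrier_mat n r" and N: "t0 < t1"
    and S: "S \<subseteq> {..<n}" "S \<noteq> {}" "balanced B {} S" "balanced A {} S \<or> balanced A S S"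
  shows "\<exists>MA MB. of_pattern (nz_class A) (nz_class B) MA MB \<and> time_invariant MA MB \<and>
    \<not> controllable n r MA MB t0 t1"
proof -
  define N where "N = nat (t1 - t0)"
  define T where "T = (if balanced A S S then S else {})"
  have "balanced A T S" using S(4) by (auto simp: T_def)
  then obtain YA where YA: "YA \<in> nz_class A" "\<And>j. j < n \<Longrightarrow> (\<Sum>k\<in>S. YA $$ (k, j)) = of_bool (j \<in> T)"
    using balanced_realizable[OF A S(1)] by blast
  obtain YB where YB: "YB \<in> nz_class B" "\<And>j. j < r \<Longrightarrow> (\<Sum>k\<in>S. YB $$ (k, j)) = 0"
    using balanced_realizable[OF B S(1,3)] by auto
  let ?S = "\<lambda>i. if i = N - 1 then S else T"
  have "\<not> controllable n r (\<lambda>_. YA) (\<lambda>_. YB) t0 t1"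
  proof (rule not_controllable_if_costate[where S = ?S, OF _ _ N_def N])
    show "(\<Sum>k\<in>?S (Suc i). YA $$ (k, j)) = of_bool (j \<in> ?S i)" if "Suc i < N" "j < n" for i j
      using that YA(2)[of j] by (auto simp: T_def split: if_splits)
    show "(\<Sum>k\<in>?S i. YB $$ (k, j)) = 0" if "i < N" "j < r" for i j
      using that YB(2)[of j] by (auto simp: T_def)
    show "?S i \<subseteq> {..<n}" for i using S(1) by (simp add: T_def)
    show "?S (N - 1) \<noteq> {}" using S(2) by simp
  qed (fact nz_class_carrier[OF YA(1) A] nz_class_carrier[OF YB(1) B])+
  moreover have "of_pattern (nz_class A) (nz_class B) (\<lambda>_. YA) (\<lambda>_. YB)"
    using YA(1) YB(1) by (simp add: of_pattern_def)
  ultimately show ?thesis by (auto simp: time_invariant_def)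
qed

section \<open>Controllability in the absence of stalled sets\<close>

text \<open>
  \<open>\<rho> y w\<close> is the defect of equation \<open>w\<close> at the assignment \<open>y\<close>. A change of the variable \<open>v\<close> by \<open>d\<close> keeps \<open>y\<close>
  admissible and changes the defects linearly. To satisfy the equations of \<open>V\<close>, take a variable that
  occurs in a single equation \<open>w\<close> of \<open>V\<close>, satisfy \<open>V - {w}\<close> first, and then repair \<open>w\<close> by this variable, which
  does not affect the others.
\<close>

lemma zero_residual_by_elimination:
  fixes \<rho> :: "'y \<Rightarrow> 'w \<Rightarrow> 'a::field"
  assumes fin: "finite W" and start: "Adm y0"
    and move: "\<And>y v d. Adm y \<Longrightarrow> v \<in> Q \<Longrightarrow> \<exists>y'. Adm y' \<and> (\<forall>w\<in>W. \<rho> y' w = \<rho> y w + c w v * d)"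
    and unique: "\<And>V. V \<subseteq> W \<Longrightarrow> V \<noteq> {} \<Longrightarrow> \<exists>v\<in>Q. \<exists>!w. w \<in> V \<and> c w v \<noteq> 0"
  shows "\<exists>y. Adm y \<and> (\<forall>w\<in>W. \<rho> y w = 0)"
proof -
  have "V \<subseteq> W \<Longrightarrow> \<exists>y. Adm y \<and> (\<forall>w\<in>V. \<rho> y w = 0)" if "finite V" for V
    using that
  proof (induction V rule: finite_psubset_induct)
    case (psubset V)
    show ?case
    proof (cases "V = {}")
      case True then show ?thesis using start by auto
    next
      case False
      with unique[OF psubset.prems] obtain v
        where v: "v \<in> Q" and ex1: "\<exists>!w. w \<in> V \<and> c w v \<noteq> 0" by blast
      then obtain w where w: "w \<in> V" "c w v \<noteq> 0"
        and only: "\<And>w'. w' \<in> V \<Longrightarrow> c w' v \<noteq> 0 \<Longrightarrow> w' = w" by blast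
      have "V - {w} \<subset> V" "V - {w} \<subseteq> W" using w psubset.prems by auto
      from psubset.IH[OF this] obtain y
        where y: "Adm y" "\<And>w'. w' \<in> V - {w} \<Longrightarrow> \<rho> y w' = 0" by blast
      from move[OF y(1) v] obtain y' where y': "Adm y'"
        "\<And>w'. w' \<in> W \<Longrightarrow> \<rho> y' w' = \<rho> y w' + c w' v * (- \<rho> y w / c w v)" by blast
      have "\<rho> y' w' = 0" if "w' \<in> V" for w'
      proof (cases "w' = w")
        case True
        then show ?thesis using y'(2)[of w] w psubset.prems by auto
      next
        case False
        then have "c w' v = 0" using only \<open>w' \<in> V\<close> by blast
        then show ?thesis using y'(2)[of w'] y(2)[of w'] \<open>w' \<in> V\<close> False psubset.prems by auto
      qed
      then show ?thesis using y'(1) by blast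
    qed
  qed
  from this[OF fin] show ?thesis by simp
qed

lemma sum_mult_fun_upd:
  fixes a f :: "nat \<Rightarrow> 'a::comm_ring"
  assumes "j < m"
  shows "(\<Sum>l<m. a l * (f(j := f j + d)) l) = (\<Sum>l<m. a l * f l) + a j * d"
proof -
  have "(\<Sum>l<m. a l * (f(j := f j + d)) l) = (\<Sum>l<m. a l * f l + (if l = j then a j * d else 0))"
    by (rule sum.cong) (auto simp: algebra_simps)
  then show ?thesis using assms by (simp add: sum.distrib)
qed

text \<open>
  The unknowns are the intermediate states \<open>x 1, \<dots>, x (N - 1)\<close> and the inputs; admissible assignments
  have the prescribed end points \<open>x 0\<close> and \<open>x N\<close>. The coefficients \<open>c\<close> of the residuals \<open>\<rho>\<close> have the
  nonzero pattern of \<open>\<K>\<close>.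
\<close>

lemma no_stalled_imp_controllable:
  fixes A B :: "'a::field mat"
  assumes A: "A \<in> carrier_mat n n" and B: "B \<in> carrier_mat n r"
    and N: "N = nat (t1 - t0)" "t0 < t1"
    and sys: "of_pattern (nz_class A) (nz_class B) MA MB" and free: "\<nexists>G. stalled A B N G"
  shows "controllable n r MA MB t0 t1"
  unfolding controllable_def
proof (intro ballI)
  fix x0 x1 :: "'a vec" assume x0: "x0 \<in> carrier_vec n" and x1: "x1 \<in> carrier_vec n"
  define a where "a i = MA (t0 + int i)" for i
  define b where "b i = MB (t0 + int i)" for i
  have a: "a i \<in> carrier_mat n n" "k < n \<Longrightarrow> j < n \<Longrightarrow> a i $$ (k, j) \<noteq> 0 \<longleftrightarrow> A $$ (k, j) \<noteq> 0" for i j k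
    using sys A by (auto simp: of_pattern_def a_def mem_nz_class_iff)
  have b: "b i \<in> carrier_mat n r" "k < n \<Longrightarrow> j < r \<Longrightarrow> b i $$ (k, j) \<noteq> 0 \<longleftrightarrow> B $$ (k, j) \<noteq> 0" for i j k
    using sys B by (auto simp: of_pattern_def b_def mem_nz_class_iff)
  define W where "W = {..<N} \<times> {..<n}"
  define \<rho> :: "(nat \<Rightarrow> nat \<Rightarrow> 'a) \<times> (nat \<Rightarrow> nat \<Rightarrow> 'a) \<Rightarrow> nat \<times> nat \<Rightarrow> 'a" where
    "\<rho> = (\<lambda>(x, u) (i, k). (\<Sum>j<n. a i $$ (k, j) * x i j) + (\<Sum>j<r. b i $$ (k, j) * u i j) - x (Suc i) k)"
  define Adm :: "(nat \<Rightarrow> nat \<Rightarrow> 'a) \<times> (nat \<Rightarrow> nat \<Rightarrow> 'a) \<Rightarrow> bool" where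
    "Adm = (\<lambda>(x, u). x 0 = vec_index x0 \<and> x N = vec_index x1)"
  define c :: "nat \<times> nat \<Rightarrow> (nat \<times> nat) + (nat \<times> nat) \<Rightarrow> 'a" where
    "c = (\<lambda>(i', k) v. case v of
       Inl (i, j) \<Rightarrow> (if i' = Suc i then a i' $$ (k, j) else if i' = i \<and> k = j then - 1 else 0)
     | Inr (i, j) \<Rightarrow> (if i' = i then b i' $$ (k, j) else 0))"
  have "\<exists>y. Adm y \<and> (\<forall>w\<in>W. \<rho> y w = 0)"
  proof (rule zero_residual_by_elimination[where Q = "grid_cols n r N" and c = c])
    show "finite W" by (simp add: W_def)
    show "Adm (\<lambda>i. if i = 0 then vec_index x0 else vec_index x1, \<lambda>_ _. 0)"
      using N by (auto simp: Adm_def)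
  next
    fix y v d assume y: "Adm y" and v: "v \<in> grid_cols n r N"
    obtain x u where y_eq: "y = (x, u)" by (cases y)
    from v consider i j where "v = Inl (i, j)" "Suc i < N" "j < n" | i j where "v = Inr (i, j)" "i < N" "j < r"
      by (auto simp: grid_cols_def)
    then show "\<exists>y'. Adm y' \<and> (\<forall>w\<in>W. \<rho> y' w = \<rho> y w + c w v * d)"
    proof cases
      case 1
      let ?x = "x(Suc i := (x (Suc i))(j := x (Suc i) j + d))"
      have "Adm (?x, u)" using y 1 by (auto simp: Adm_def y_eq)
      moreover have "\<rho> (?x, u) w = \<rho> y w + c w v * d" for w
      proof (cases w)
        case (Pair p q)
        have upd: "?x (Suc p) q = x (Suc p) q + (if p = i \<and> q = j then d else 0)" by simp
        have "(\<Sum>l<n. a p $$ (q, l) * ?x p l) =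
            (\<Sum>l<n. a p $$ (q, l) * x p l) + (if p = Suc i then a p $$ (q, j) * d else 0)"
          using sum_mult_fun_upd[OF 1(3), of "\<lambda>l. a p $$ (q, l)" "x (Suc i)" d]
          by (cases "p = Suc i") simp_all
        with upd show ?thesis
          unfolding \<rho>_def c_def y_eq Pair 1(1) by (simp del: fun_upd_apply)
      qed
      ultimately show ?thesis by blast
    next
      case 2
      let ?u = "u(i := (u i)(j := u i j + d))"
      have "Adm (x, ?u)" using y by (auto simp: Adm_def y_eq)
      moreover have "\<rho> (x, ?u) w = \<rho> y w + c w v * d" for w
      proof (cases w)
        case (Pair p q)
        have "(\<Sum>l<r. b p $$ (q, l) * ?u p l) =
            (\<Sum>l<r. b p $$ (q, l) * u p l) + (if p = i then b p $$ (q, j) * d else 0)"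
          using sum_mult_fun_upd[OF 2(3), of "\<lambda>l. b p $$ (q, l)" "u i" d]
          by (cases "p = i") simp_all
        then show ?thesis
          unfolding \<rho>_def c_def y_eq Pair 2(1) by (simp del: fun_upd_apply)
      qed
      ultimately show ?thesis by blast
    qed
  next
    fix V assume V: "V \<subseteq> W" "V \<noteq> {}"
    then obtain v where v: "v \<in> grid_cols n r N" "\<exists>!w. w \<in> V \<and> grid_arc A B v w"
      using stalled_iff_no_unique_arc[OF A B, of V N] free unfolding W_def by blast
    have "c w v \<noteq> 0 \<longleftrightarrow> grid_arc A B v w" if "w \<in> V" for w
    proof -
      obtain p q where w: "w = (p, q)" "q < n" using \<open>w \<in> V\<close> V(1) by (auto simp: W_def)
      from v(1) consider i j where "v = Inl (i, j)" "j < n" | i j where "v = Inr (i, j)" "j < r"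
        by (auto simp: grid_cols_def)
      then show ?thesis
      proof cases
        case 1 then show ?thesis using a(2)[OF w(2) 1(2), of p] by (auto simp: c_def w(1))
      next
        case 2 then show ?thesis using b(2)[OF w(2) 2(2), of p] by (auto simp: c_def w(1))
      qed
    qed
    then have "(\<lambda>w. w \<in> V \<and> c w v \<noteq> 0) = (\<lambda>w. w \<in> V \<and> grid_arc A B v w)"
      by (intro ext conj_cong refl)
    with v(2) have "\<exists>!w. w \<in> V \<and> c w v \<noteq> 0" by simp
    with v(1) show "\<exists>v\<in>grid_cols n r N. \<exists>!w. w \<in> V \<and> c w v \<noteq> 0" by blast
  qed
  then obtain y where y: "Adm y" "\<forall>w\<in>W. \<rho> y w = 0" by blast
  obtain x u where xu: "y = (x, u)" by (cases y)
  have adm: "Adm (x, u)" and res: "\<And>i k. i < N \<Longrightarrow> k < n \<Longrightarrow> \<rho> (x, u) (i, k) = 0"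
    using y by (simp_all add: xu W_def)
  define U where "U t = vec r (u (nat (t - t0)))" for t
  have "state_after MA MB t0 x0 U i = vec n (x i)" if "i \<le> N" for i
    using that
  proof (induction i)
    case 0
    show ?case using x0 adm by (auto simp: Adm_def)
  next
    case (Suc i)
    then have "state_after MA MB t0 x0 U (Suc i) = a i *\<^sub>v vec n (x i) + b i *\<^sub>v vec r (u i)"
      by (simp add: a_def b_def) (simp add: U_def)
    also have "\<dots> = vec n (x (Suc i))"
    proof (rule eq_vecI)
      fix k assume "k < dim_vec (vec n (x (Suc i)))"
      then have k: "k < n" by simp
      have "(a i *\<^sub>v vec n (x i) + b i *\<^sub>v vec r (u i)) $ k =
          (\<Sum>j<n. a i $$ (k, j) * x i j) + (\<Sum>j<r. b i $$ (k, j) * u i j)"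
        using k a(1)[of i] b(1)[of i] by (auto simp: scalar_prod_def atLeast0LessThan intro!: arg_cong2[where f = "(+)"] sum.cong)
      then show "(a i *\<^sub>v vec n (x i) + b i *\<^sub>v vec r (u i)) $ k = vec n (x (Suc i)) $ k"
        using res[of i k] k Suc.prems by (simp add: \<rho>_def)
    qed (use b(1)[of i] in auto)
    finally show ?case .
  qed
  from this[of N] have "phi MA MB t1 t0 x0 U = vec n (x N)" by (simp add: phi_def N)
  also have "\<dots> = x1" using adm x1 by (auto simp: Adm_def)
  finally show "\<exists>u. (\<forall>t\<in>{t0..<t1}. u t \<in> carrier_vec r) \<and> x1 = phi MA MB t1 t0 x0 u"
    by (intro exI[of _ U]) (simp add: U_def)
qed

section \<open>Long stalled sets contain a stationary one\<close>

text \<open>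
  \<open>U l m\<close> is the union of the slices \<open>l, \<dots>, m\<close>. It is balanced for the inputs, so unless it is stationary,
  some state \<open>j\<close> violates \<open>balanced A (U l m) (U l m)\<close>. There are two ways in which this can happen: \<open>j\<close> is a
  dead end in the union, then it lies in the last slice only (\<open>dead_end\<close>), or \<open>j\<close> is outside and has
  a single successor \<open>w\<close> in the union, then \<open>w\<close> lies in the first slice only (\<open>unique_arc\<close>). Either way a
  shorter union is strictly smaller, whence the cardinality bound \<open>card_U\<close>.
\<close>

lemma stalled_imp_stationary:
  fixes A B :: "'a::zero mat"
  assumes A: "A \<in> carrier_mat n n" and B: "B \<in> carrier_mat n r"
    and G: "stalled A B N G" and N: "1 \<le> n" "n \<le> N"
  shows "\<exists>S\<subseteq>{..<n}. S \<noteq> {} \<and> balanced B {} S \<and> (balanced A {} S \<or> balanced A S S)"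
proof (rule ccontr)
  assume "\<not> ?thesis"
  then have no: "\<not> balanced A {} S" "\<not> balanced A S S"
    if "S \<subseteq> {..<n}" "S \<noteq> {}" "balanced B {} S" for S using that by blast+
  define V where "V i = G `` {i}" for i
  define U where "U l m = (\<Union>i\<in>{l..m}. V i)" for l m
  have V: "V i \<subseteq> {..<n}" for i using stalled_slice_subset[OF G] A by (auto simp: V_def)
  have VA: "balanced A (V i) (V (Suc i))" if "Suc i < N" for i
    using G that by (simp add: stalled_def V_def)
  have VB: "balanced B {} (V i)" if "i < N" for i using G that by (simp add: stalled_def V_def)
  have VAD: "card {k\<in>V (Suc i). A $$ (k, j) \<noteq> 0} + of_bool (j \<in> V i) \<noteq> 1" if "Suc i < N" "j < n" for i j
    using VA[OF that(1)] that A by (auto simp: balanced_def)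
  \<comment> \<open>The first nonempty slice after an empty one would be a stationary support for the eigenvalue \<open>0\<close>.\<close>
  have V0: "V 0 \<noteq> {}"
  proof
    assume V0: "V 0 = {}"
    have "V i = {}" if "i < N" for i
      using that
    proof (induction i)
      case (Suc i)
      then have "balanced A {} (V (Suc i))" using VA[of i] by simp
      then show ?case using no(1) V VB Suc.prems by blast
    qed (use V0 in simp)
    then show False using G by (auto simp: stalled_def V_def)
  qed
  have Vne: "V i \<noteq> {}" if "i < N" for i
    using that
  proof (induction i)
    case (Suc i)
    then show ?case using stalled_slice_nonempty_step[OF G A, of i] by (simp add: V_def)
  qed (use V0 in simp)
  have VU: "V i \<subseteq> U l m" if "l \<le> i" "i \<le> m" for i l m using that by (auto simp: U_def)
  have UU: "U l' m' \<subseteq> U l m" if "l \<le> l'" "m' \<le> m" for l l' m m'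
    unfolding U_def using that by (intro UN_mono) auto
  have U: "U l m \<subseteq> {..<n}" for l m using V by (auto simp: U_def)
  then have finU: "finite (U l m)" for l m by (rule finite_subset) simp
  have Une: "U l m \<noteq> {}" if "l \<le> m" "m < N" for l m
    using Vne[of l] that by (auto simp: U_def)
  have UB: "balanced B {} (U l m)" if "m < N" for l m
    unfolding U_def using that by (intro balanced_UN VB) auto
  have UA: "\<exists>j<n. (j \<in> U l m \<and> (\<forall>k\<in>U l m. A $$ (k, j) = 0)) \<or>
      (j \<notin> U l m \<and> (\<exists>w. {k\<in>U l m. A $$ (k, j) \<noteq> 0} = {w}))" if lm: "l \<le> m" "m < N" for l m
  proof -
    obtain j where j: "j < n" "card {k\<in>U l m. A $$ (k, j) \<noteq> 0} + of_bool (j \<in> U l m) = 1"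
      using no(2)[OF U Une[OF lm] UB[OF lm(2)]] A by (auto simp: balanced_def)
    show ?thesis
    proof (cases "j \<in> U l m")
      case True
      then have "{k\<in>U l m. A $$ (k, j) \<noteq> 0} = {}" using j(2) finU[of l m] by simp
      then show ?thesis using True j(1) by blast
    next
      case False
      then have "card {k\<in>U l m. A $$ (k, j) \<noteq> 0} = 1" using j(2) by simp
      then obtain w where "{k\<in>U l m. A $$ (k, j) \<noteq> 0} = {w}" by (rule card_1_singletonE)
      then show ?thesis using False j(1) by blast
    qed
  qed
  have dead_end: "j \<notin> U l (m - 1)"
    if "l < m" "m < N" "j \<in> U l m" "\<forall>k\<in>U l m. A $$ (k, j) = 0" for l m j
  proof
    assume "j \<in> U l (m - 1)"
    then obtain i where i: "l \<le> i" "i \<le> m - 1" "j \<in> V i" by (auto simp: U_def)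
    then have "V (Suc i) \<subseteq> U l m" using that(1) by (intro VU) auto
    then have none: "{k\<in>V (Suc i). A $$ (k, j) \<noteq> 0} = {}" using that(4) by blast
    have "Suc i < N" "j < n" using i that V by auto
    from VAD[OF this] show False unfolding none using i(3) by simp
  qed
  have unique_arc: "w \<notin> U (Suc l) m"
    if "l < m" "m < N" "j < n" "j \<notin> U l m" "{k\<in>U l m. A $$ (k, j) \<noteq> 0} = {w}" for l m j w
  proof
    assume "w \<in> U (Suc l) m"
    then obtain i' where i': "Suc l \<le> i'" "i' \<le> m" "w \<in> V i'" by (auto simp: U_def)
    then obtain i where i: "l \<le> i" "Suc i \<le> m" "w \<in> V (Suc i)" by (cases i') auto
    then have "V (Suc i) \<subseteq> U l m" by (intro VU) auto
    then have one: "{k\<in>V (Suc i). A $$ (k, j) \<noteq> 0} = {w}" using that(5) i(3) by blast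
    have "j \<notin> V i" using VU[of l i m] i that(4) by auto
    then show False using VAD[of i j] i that unfolding one by simp
  qed
  have card_U: "m - l < card (U l m)" if "l \<le> m" "m < N" for l m
    using that
  proof (induction "m - l" arbitrary: l m)
    case 0
    then show ?case using Une[of l m] finU[of l m] by (simp add: card_gt_0_iff)
  next
    case (Suc d)
    then have lm: "l < m" by simp
    obtain j where j: "j < n" and cases: "(j \<in> U l m \<and> (\<forall>k\<in>U l m. A $$ (k, j) = 0)) \<or>
      (j \<notin> U l m \<and> (\<exists>w. {k\<in>U l m. A $$ (k, j) \<noteq> 0} = {w}))"
      using UA[OF Suc.prems] by blast
    from cases have "U l (m - 1) \<subset> U l m \<or> U (Suc l) m \<subset> U l m"
    proof
      assume "j \<in> U l m \<and> (\<forall>k\<in>U l m. A $$ (k, j) = 0)"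
      moreover have "U l (m - 1) \<subseteq> U l m" by (rule UU) auto
      ultimately show ?thesis using dead_end[OF lm Suc.prems(2)] by blast
    next
      assume "j \<notin> U l m \<and> (\<exists>w. {k\<in>U l m. A $$ (k, j) \<noteq> 0} = {w})"
      then obtain w where "j \<notin> U l m" and w: "{k\<in>U l m. A $$ (k, j) \<noteq> 0} = {w}" by blast
      then have "w \<notin> U (Suc l) m" using unique_arc[OF lm Suc.prems(2) j] by blast
      moreover have "w \<in> U l m" using w by blast
      moreover have "U (Suc l) m \<subseteq> U l m" by (rule UU) auto
      ultimately show ?thesis by blast
    qed
    then have "card (U l (m - 1)) < card (U l m) \<or> card (U (Suc l) m) < card (U l m)"
      using psubset_card_mono[OF finU] by blast
    moreover have "m - 1 - l < card (U l (m - 1))" "m - Suc l < card (U (Suc l) m)"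
      using Suc.hyps(1)[of "m - 1" l] Suc.hyps(1)[of m "Suc l"] Suc.hyps(2) Suc.prems lm by auto
    ultimately show ?case using Suc.hyps(2) by linarith
  qed
  \<comment> \<open>The bound is sharp for the first \<open>n\<close> slices. The second part of the invariant, which excludes the
      case of an outside state with a single successor, persists because the state that is peeled off
      is a dead end.\<close>
  have prefix: "card (U 0 m) = Suc m \<and> (\<forall>j<n. j \<notin> U 0 m \<longrightarrow> (\<forall>k\<in>U 0 m. A $$ (k, j) = 0))"
    if "m \<le> n - 1" for m
    using that
  proof (induction m rule: inc_induct)
    case base
    have "card (U 0 (n - 1)) \<ge> n" using card_U[of 0 "n - 1"] N by linarith
    then have "U 0 (n - 1) = {..<n}"
      using U by (metis card_lessThan card_seteq finite_lessThan)
    then show ?case using N by simp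
  next
    case (step m)
    then have m: "Suc m < N" using N by simp
    obtain j where "j < n" and j: "j \<in> U 0 (Suc m)" "\<forall>k\<in>U 0 (Suc m). A $$ (k, j) = 0"
      using UA[of 0 "Suc m"] m step.IH by blast
    have notin: "j \<notin> U 0 m" using dead_end[of 0 "Suc m"] m j by simp
    have "U 0 m \<subseteq> U 0 (Suc m) - {j}" using notin UU[of 0 0 m "Suc m"] by auto
    moreover have "card (U 0 (Suc m) - {j}) = Suc m" using step.IH j(1) by simp
    moreover have "Suc m \<le> card (U 0 m)" using card_U[of 0 m] m by simp
    ultimately have eq: "U 0 m = U 0 (Suc m) - {j}"
      using finU by (metis card_seteq finite_Diff)
    show ?case
    proof (intro conjI allI impI ballI)
      show "card (U 0 m) = Suc m" using eq step.IH j(1) by simp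
    next
      fix i k assume "i < n" "i \<notin> U 0 m" "k \<in> U 0 m"
      then show "A $$ (k, i) = 0" using eq j(2) step.IH by blast
    qed
  qed
  have U00: "U 0 0 = V 0" by (simp add: U_def)
  obtain w where w: "V 0 = {w}"
    using prefix[of 0] card_1_singletonE unfolding U00 by force
  have N0: "0 < N" using N by simp
  have no_in: "A $$ (w, j) = 0" if "j < n" "j \<noteq> w" for j
    using prefix[of 0] that unfolding U00 w by auto
  \<comment> \<open>The set \<open>{w}\<close> is not stationary for the eigenvalue \<open>1\<close>, which excludes a loop at \<open>w\<close>, and without any
      arc into \<open>w\<close> it is stationary for the eigenvalue \<open>0\<close>.\<close>
  from UA[of 0 0, OF order_refl N0, unfolded U00 w] obtain j where j: "j < n"
    and cases: "(j \<in> {w} \<and> (\<forall>k\<in>{w}. A $$ (k, j) = 0)) \<or>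
      (j \<notin> {w} \<and> (\<exists>v. {k\<in>{w}. A $$ (k, j) \<noteq> 0} = {v}))" by blast
  from cases have "A $$ (w, w) = 0"
  proof
    assume "j \<notin> {w} \<and> (\<exists>v. {k\<in>{w}. A $$ (k, j) \<noteq> 0} = {v})"
    then obtain v where "j \<noteq> w" and v: "{k\<in>{w}. A $$ (k, j) \<noteq> 0} = {v}" by blast
    have "v \<in> {k\<in>{w}. A $$ (k, j) \<noteq> 0}" unfolding v by simp
    then have "A $$ (w, j) \<noteq> 0" by blast
    then show ?thesis using no_in[OF j \<open>j \<noteq> w\<close>] by simp
  qed auto
  then have zero: "A $$ (w, j) = 0" if "j < n" for j using no_in that by blast
  have "balanced A {} (V 0)"
    unfolding balanced_def w
  proof (intro allI impI)
    fix j assume "j < dim_col A"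
    then have none: "{k\<in>{w}. A $$ (k, j) \<noteq> 0} = {}" using zero A by auto
    show "card {k\<in>{w}. A $$ (k, j) \<noteq> 0} + of_bool (j \<in> {}) \<noteq> 1" unfolding none by simp
  qed
  then show False using no(1) V V0 VB[OF N0] by blast
qed

lemma pattern_representative:
  assumes "P \<in> patterns p q"
  obtains X where "X \<in> carrier_mat p q" "P = nz_class X"
  using assms unfolding patterns_def by (auto elim!: quotientE simp: nz_class_def)

lemma pattern_controllability:
  fixes \<A> \<B> :: "'a::field_char_0 mat set"
  assumes "1 \<le> n" and t: "t0 < t1" and N: "N = nat (t1 - t0)"
    and P: "\<A> \<in> patterns n n" "\<B> \<in> patterns n r"
  shows "((\<forall>A B. of_pattern \<A> \<B> A B \<longrightarrow> controllable n r A B t0 t1)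
          \<longleftrightarrow> cond_G3 (n * N) ((n + r) * N) (K_pattern n r N \<A> \<B>)) \<and>
       (t0 + int n \<le> t1 \<longrightarrow>
          ((\<forall>A B. of_pattern \<A> \<B> A B \<longrightarrow> controllable n r A B t0 t1)
             \<longleftrightarrow> (\<forall>A B. of_pattern \<A> \<B> A B \<and> time_invariant A B \<longrightarrow> controllable n r A B t0 t1)))"
proof -
  obtain A where A: "A \<in> carrier_mat n n" "\<A> = nz_class A" using P(1) by (rule pattern_representative)
  obtain B where B: "B \<in> carrier_mat n r" "\<B> = nz_class B" using P(2) by (rule pattern_representative)
  have all_iff: "(\<forall>MA MB. of_pattern \<A> \<B> MA MB \<longrightarrow> controllable n r MA MB t0 t1) \<longleftrightarrow>
      (\<nexists>G. stalled A B N G)"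
    using stalled_imp_uncontrollable[OF A(1) B(1) N t] no_stalled_imp_controllable[OF A(1) B(1) N t]
    unfolding A(2) B(2) by blast
  have "\<exists>MA MB. of_pattern \<A> \<B> MA MB \<and> time_invariant MA MB \<and> \<not> controllable n r MA MB t0 t1"
    if "t0 + int n \<le> t1" "stalled A B N G" for G
  proof -
    have "n \<le> N" using that(1) N by simp
    then obtain S where "S \<subseteq> {..<n}" "S \<noteq> {}" "balanced B {} S" "balanced A {} S \<or> balanced A S S"
      using stalled_imp_stationary[OF A(1) B(1) \<open>stalled A B N G\<close> assms(1)] by blast
    then show ?thesis
      using balanced_imp_time_invariant_uncontrollable[OF A(1) B(1) t] unfolding A(2) B(2) by blast
  qed
  then show ?thesis
    using all_iff cond_G3_iff_no_stalled[OF A(1) B(1), of N] unfolding A(2) B(2) by blast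
qed

theorem theorem2:
  fixes n r N :: nat and t0 t1 :: int
  assumes "1 \<le> n" and "t0 < t1" and "N = nat (t1 - t0)"
  shows
    "(\<forall>\<A>\<in>(patterns n n :: real mat set set). \<forall>\<B>\<in>(patterns n r :: real mat set set).
       ((\<forall>A B. of_pattern \<A> \<B> A B \<longrightarrow> controllable n r A B t0 t1)
          \<longleftrightarrow> cond_G3 (n * N) ((n + r) * N) (K_pattern n r N \<A> \<B>)) \<and>
       (t0 + int n \<le> t1 \<longrightarrow>
          ((\<forall>A B. of_pattern \<A> \<B> A B \<longrightarrow> controllable n r A B t0 t1)
             \<longleftrightarrow> (\<forall>A B. of_pattern \<A> \<B> A B \<and> time_invariant A B \<longrightarrow> controllable n r A B t0 t1)))) \<and>
     (\<forall>\<A>\<in>(patterns n n :: complex mat set set). \<forall>\<B>\<in>(patterns n r :: complex mat set set).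
       ((\<forall>A B. of_pattern \<A> \<B> A B \<longrightarrow> controllable n r A B t0 t1)
          \<longleftrightarrow> cond_G3 (n * N) ((n + r) * N) (K_pattern n r N \<A> \<B>)) \<and>
       (t0 + int n \<le> t1 \<longrightarrow>
          ((\<forall>A B. of_pattern \<A> \<B> A B \<longrightarrow> controllable n r A B t0 t1)
             \<longleftrightarrow> (\<forall>A B. of_pattern \<A> \<B> A B \<and> time_invariant A B \<longrightarrow> controllable n r A B t0 t1))))"
  by (rule conjI; intro ballI; rule pattern_controllability[OF assms])

end
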